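(* Let $\mathcal{E}$ be a Hilbert $K(\mathcal{H})$-module and let $x, y \in \mathcal{E}$. Then the following statements are equivalent: (i) $\theta_{x,x} \| \theta_{y,y}$; (ii) there exist a sequence $\{x_n\}$ of basic vectors in $\mathcal{E}$, with $\langle x_n,x_n\rangle=\xi_n\otimes\xi_n$ for unit vectors $\xi_n\in\mathcal{H}$ ($n\in\mathbb{N}$), and some $\lambda\in\mathbb{T}$ such that $$\lim_n [\langle x_n, x \rangle \langle x, y \rangle \langle y , x_n \rangle \xi_n , \xi_n ] = \lambda \| x\|^2 \| y\|^2;$$ (iii) $\| \langle x, y \rangle\| = \| x\|\| y\|$.
   Context: $(\mathcal{H}, [\cdot,\cdot])$ is a complex Hilbert space and $K(\mathcal{H})$ is the $C^*$-algebra of compact linear operators on $\mathcal{H}$. A (left) Hilbert $\mathcal{A}$-module over a $C^*$-algebra $\mathcal{A}$ is a left $\mathcal{A}$-module with an $\mathcal{A}$-valued inner product $\langle\cdot,\cdot\rangle$, linear in the first variable and conjugate linear in the second, such that $\langle tx,y\rangle=t\langle x,y\rangle$ for $t\in\mathcal{A}$, $\langle x,y\rangle^*=\langle y,x\rangle$, $\langle x,x\rangle\ge 0$ with equality iff $x=0$, and which is complete for the norm $\|x\|=\|\langle x,x\rangle\|^{1/2}$. For $x,y\in\mathcal{E}$, $\theta_{x,y}:\mathcal{E}\to\mathcal{E}$ is $\theta_{x,y}(z)=\langle z,y\rangle x$, considered in the space $\mathcal{L}(\mathcal{E})$ of adjointable maps with the operator norm. For $\xi,\eta\in\mathcal{H}$,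 $\xi\otimes\eta$ is the operator $\nu\mapsto[\nu,\eta]\xi$. A projection $e\in K(\mathcal{H})$ is minimal if $eB(\mathcal{H})e=\mathbb{C}e$, equivalently $e=\xi\otimes\xi$ for a unit vector $\xi\in\mathcal{H}$. A vector $x\in\mathcal{E}$ is basic if $\langle x,x\rangle$ is a minimal projection. Norm-parallelism: for elements $x,y$ of a complex normed space, $x\|y$ means $\|x+\lambda y\|=\|x\|+\|y\|$ for some $\lambda\in\mathbb{T}=\{\alpha\in\mathbb{C}:|\alpha|=1\}$.
   Formalization: The formal statement assumes that the module E is nonzero; for E = {0} there are no basic vectors, so (ii) fails while (i) and (iii) hold for x = y = 0. *)

theory Defs
  imports "HOL-Analysis.Analysis"
begin

section \<open>Complex normed spaces and complex Hilbert spaces\<close>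

class complex_vector = real_vector +
  fixes scaleC :: "complex \<Rightarrow> 'a \<Rightarrow> 'a"  (infixr "*\<^sub>C" 75)
  assumes scaleC_add_right: "a *\<^sub>C (x + y) = a *\<^sub>C x + a *\<^sub>C y"
    and scaleC_add_left: "(a + b) *\<^sub>C x = a *\<^sub>C x + b *\<^sub>C x"
    and scaleC_scaleC: "a *\<^sub>C b *\<^sub>C x = (a * b) *\<^sub>C x"
    and scaleC_one: "1 *\<^sub>C x = x"
    and scaleR_scaleC: "r *\<^sub>R x = complex_of_real r *\<^sub>C x"

class complex_normed_vector = complex_vector + real_normed_vector +
  assumes norm_scaleC: "norm (a *\<^sub>C x) = cmod a * norm x"

text \<open>The complex inner product is linear in the \<^emph>\<open>first\<close> variable. Its real part is the
  real inner product of the class \<^class>\<open>real_inner\<close>, so it induces the norm and is positive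
  definite.\<close>

class complex_inner = complex_vector + real_inner +
  fixes cinner :: "'a \<Rightarrow> 'a \<Rightarrow> complex"
  assumes cinner_commute: "cinner x y = cnj (cinner y x)"
    and cinner_add_left: "cinner (x + y) z = cinner x z + cinner y z"
    and cinner_scaleC_left: "cinner (a *\<^sub>C x) y = a * cinner x y"
    and Re_cinner: "Re (cinner x y) = inner x y"

class chilbert_space = complex_inner + complete_space

lemma scaleC_minus_one: "(-1) *\<^sub>C x = - (x :: 'a :: complex_vector)"
  using scaleR_scaleC[of "-1" x] by simp

lemma cinner_self: "cinner x x = complex_of_real ((norm (x :: 'a :: complex_inner))\<^sup>2)"
proof (rule complex_eqI)
  show "Re (cinner x x) = Re (complex_of_real ((norm x)\<^sup>2))"
    by (simp add: Re_cinner power2_norm_eq_inner)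
  have "Im (cinner x x) = - Im (cinner x x)"
    using arg_cong[OF cinner_commute[of x x], of Im] by simp
  then show "Im (cinner x x) = Im (complex_of_real ((norm x)\<^sup>2))" by simp
qed

lemma cinner_scaleC_right: "cinner x (a *\<^sub>C y) = cnj a * cinner (x :: 'a :: complex_inner) y"
proof -
  have "cinner x (a *\<^sub>C y) = cnj (cinner (a *\<^sub>C y) x)" by (rule cinner_commute)
  also have "\<dots> = cnj a * cnj (cinner y x)" by (simp add: cinner_scaleC_left)
  also have "\<dots> = cnj a * cinner x y" by (simp flip: cinner_commute)
  finally show ?thesis .
qed

instance complex_inner \<subseteq> complex_normed_vector
proof
  fix a :: complex and x :: 'a
  have "complex_of_real ((norm (a *\<^sub>C x))\<^sup>2) = a * (cnj a * cinner x x)"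
    by (simp only: cinner_self[symmetric] cinner_scaleC_left cinner_scaleC_right mult.left_commute)
  also have "\<dots> = (a * cnj a) * cinner x x" by (simp only: mult.assoc)
  also have "\<dots> = complex_of_real ((cmod a * norm x)\<^sup>2)"
    by (simp only: cinner_self complex_norm_square[symmetric] power_mult_distrib of_real_mult)
  finally have "(norm (a *\<^sub>C x))\<^sup>2 = (cmod a * norm x)\<^sup>2" by (simp only: of_real_eq_iff)
  then show "norm (a *\<^sub>C x) = cmod a * norm x"
    by (rule power2_eq_imp_eq) auto
qed

lemma bounded_linear_scaleC:
  "bounded_linear (\<lambda>x :: 'a :: complex_normed_vector. a *\<^sub>C x)"
proof (rule bounded_linear_intro)
  show "a *\<^sub>C (x + y) = a *\<^sub>C x + a *\<^sub>C y" for x y :: 'a by (rule scaleC_add_right)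
  show "a *\<^sub>C r *\<^sub>R x = r *\<^sub>R a *\<^sub>C x" for r and x :: 'a
    by (simp add: scaleR_scaleC scaleC_scaleC mult.commute)
  show "norm (a *\<^sub>C x) \<le> norm x * cmod a" for x :: 'a
    by (simp add: norm_scaleC mult.commute)
qed

text \<open>The type \<open>'a \<Rightarrow>\<^sub>L 'b\<close> consists of the bounded \<^emph>\<open>real\<close>-linear maps with the operator norm;
  complex linearity is imposed by a predicate below. Scalars act on the values.\<close>

instantiation blinfun :: (real_normed_vector, complex_normed_vector) complex_normed_vector
begin

lift_definition scaleC_blinfun :: "complex \<Rightarrow> 'a \<Rightarrow>\<^sub>L 'b \<Rightarrow> 'a \<Rightarrow>\<^sub>L 'b"
  is "\<lambda>a f x. a *\<^sub>C f x"
  by (rule bounded_linear_compose[OF bounded_linear_scaleC])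

instance
proof
  fix a b :: complex and r :: real and f g :: "'a \<Rightarrow>\<^sub>L 'b"
  show "a *\<^sub>C (f + g) = a *\<^sub>C f + a *\<^sub>C g"
    by transfer (simp add: scaleC_add_right)
  show "(a + b) *\<^sub>C f = a *\<^sub>C f + b *\<^sub>C f"
    by transfer (simp add: scaleC_add_left)
  show "a *\<^sub>C b *\<^sub>C f = (a * b) *\<^sub>C f"
    by transfer (simp add: scaleC_scaleC)
  show "1 *\<^sub>C f = f"
    by transfer (simp add: scaleC_one)
  show "r *\<^sub>R f = complex_of_real r *\<^sub>C f"
    by transfer (simp add: scaleR_scaleC)
  have le: "norm (c *\<^sub>C h) \<le> cmod c * norm h" for c and h :: "'a \<Rightarrow>\<^sub>L 'b"
  proof (rule norm_blinfun_bound)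
    show "norm (blinfun_apply (c *\<^sub>C h) x) \<le> cmod c * norm h * norm x" for x
      using norm_blinfun[of h x]
      by (simp add: scaleC_blinfun.rep_eq norm_scaleC mult.assoc mult_left_mono)
  qed simp
  show "norm (a *\<^sub>C f) = cmod a * norm f"
  proof (cases "a = 0")
    case True
    then show ?thesis using le[of a f] by simp
  next
    case False
    have "f = inverse a *\<^sub>C a *\<^sub>C f"
      using False by transfer (simp add: scaleC_scaleC scaleC_one)
    then have "norm f \<le> cmod (inverse a) * norm (a *\<^sub>C f)" using le by metis
    then have "cmod a * norm f \<le> norm (a *\<^sub>C f)"
      using False by (simp add: norm_inverse norm_divide field_simps)
    with le[of a f] show ?thesis by simp
  qed
qed

end

lemma semi_inner_Cauchy_Schwarz:
  fixes f :: "'a :: complex_vector \<Rightarrow> 'a \<Rightarrow> complex"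
  assumes add: "\<And>x y z. f (x + y) z = f x z + f y z"
    and scale: "\<And>a x y. f (a *\<^sub>C x) y = a * f x y"
    and herm: "\<And>x y. f x y = cnj (f y x)"
    and pos: "\<And>x. 0 \<le> Re (f x x)"
  shows "(cmod (f x y))\<^sup>2 \<le> Re (f x x) * Re (f y y)"
proof -
  define m where "m = (cmod (f x y))\<^sup>2"
  have addr: "f x (y + z) = f x y + f x z" for x y z
    using herm[of x "y + z"] herm[of x y] herm[of x z] by (simp add: add)
  have scaler: "f x (a *\<^sub>C y) = cnj a * f x y" for a x y
    using herm[of x "a *\<^sub>C y"] herm[of x y] by (simp add: scale)
  have m: "f x y * f y x = of_real m"
    using herm[of y x] by (simp add: m_def complex_norm_square[symmetric])
  have key: "0 \<le> Re (f x x) - 2 * s * m + s\<^sup>2 * m * Re (f y y)" for s :: real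
  proof -
    define t where "t = - (of_real s * f x y)"
    have t1: "t * f y x = of_real (- (s * m))"
      using m by (simp add: t_def mult.assoc)
    have t2: "cnj t * f x y = of_real (- (s * m))"
      using m herm[of y x] by (simp add: t_def mult.assoc mult.commute)
    have t3: "t * cnj t = of_real (s\<^sup>2 * m)"
      unfolding complex_norm_square[symmetric]
      by (simp add: t_def m_def norm_mult power_mult_distrib)
    have "f (x + t *\<^sub>C y) (x + t *\<^sub>C y)
        = f x x + cnj t * f x y + (t * f y x + t * cnj t * f y y)"
      by (simp add: add addr scale scaler algebra_simps)
    also have "\<dots> = f x x + of_real (- (s * m)) + (of_real (- (s * m)) + of_real (s\<^sup>2 * m) * f y y)"
      by (simp only: t1 t2 t3)
    finally have "Re (f (x + t *\<^sub>C y) (x + t *\<^sub>C y)) = Re (f x x) - 2 * s * m + s\<^sup>2 * m * Re (f y y)"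
      by simp
    with pos[of "x + t *\<^sub>C y"] show ?thesis by simp
  qed
  show ?thesis
  proof (cases "Re (f y y) = 0")
    case True
    have "m = 0"
    proof (rule ccontr)
      assume "m \<noteq> 0"
      then show False using key[of "(Re (f x x) + 1) / (2 * m)"] True by simp
    qed
    then show ?thesis using True by (simp add: m_def)
  next
    case False
    with pos[of y] have p: "Re (f y y) > 0" by linarith
    have "0 \<le> Re (f x x) - m / Re (f y y)"
      using key[of "1 / Re (f y y)"] p by (simp add: power2_eq_square)
    then show ?thesis using p by (simp add: m_def field_simps)
  qed
qed

lemma cinner_Cauchy_Schwarz:
  "cmod (cinner x y) \<le> norm x * norm (y :: 'a :: complex_inner)"
proof -
  have "(cmod (cinner x y))\<^sup>2 \<le> Re (cinner x x) * Re (cinner y y)"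
    by (rule semi_inner_Cauchy_Schwarz)
      (auto simp: cinner_add_left cinner_scaleC_left Re_cinner intro: cinner_commute)
  also have "\<dots> = (norm x * norm y)\<^sup>2"
    by (simp add: cinner_self power_mult_distrib)
  finally show ?thesis by (rule power2_le_imp_le) simp
qed

section \<open>Norm-parallelism\<close>

definition norm_parallel :: "'a :: complex_normed_vector \<Rightarrow> 'a \<Rightarrow> bool" where
  "norm_parallel x y \<longleftrightarrow> (\<exists>c. cmod c = 1 \<and> norm (x + c *\<^sub>C y) = norm x + norm y)"

section \<open>Operators on a complex Hilbert space\<close>

definition bounded_operators :: "('h :: chilbert_space \<Rightarrow>\<^sub>L 'h) set" where
  "bounded_operators = {T. \<forall>a \<xi>. blinfun_apply T (a *\<^sub>C \<xi>) = a *\<^sub>C blinfun_apply T \<xi>}"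

definition compact_operators :: "('h :: chilbert_space \<Rightarrow>\<^sub>L 'h) set" where
  "compact_operators = {T \<in> bounded_operators. compact (closure (blinfun_apply T ` cball 0 1))}"

text \<open>\<open>is_adjoint S T\<close> means \<open>S = T\<^sup>*\<close>; such an \<open>S\<close> is unique.\<close>

definition is_adjoint :: "('h :: chilbert_space \<Rightarrow>\<^sub>L 'h) \<Rightarrow> ('h \<Rightarrow>\<^sub>L 'h) \<Rightarrow> bool" where
  "is_adjoint S T \<longleftrightarrow> (\<forall>\<xi> \<eta>. cinner (S \<xi>) \<eta> = cinner \<xi> (T \<eta>))"

definition positive_operator :: "('h :: chilbert_space \<Rightarrow>\<^sub>L 'h) \<Rightarrow> bool" where
  "positive_operator T \<longleftrightarrow> (\<forall>\<xi>. cinner (T \<xi>) \<xi> \<in> \<real>\<^sub>\<ge>\<^sub>0)"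

definition rank_one :: "'h :: chilbert_space \<Rightarrow> 'h \<Rightarrow> 'h \<Rightarrow>\<^sub>L 'h"  (infix "\<otimes>\<^sub>H" 70) where
  "\<xi> \<otimes>\<^sub>H \<eta> = Blinfun (\<lambda>\<nu>. cinner \<nu> \<eta> *\<^sub>C \<xi>)"

lemma rank_one_apply [simp]: "blinfun_apply (\<xi> \<otimes>\<^sub>H \<eta>) \<nu> = cinner \<nu> \<eta> *\<^sub>C \<xi>"
proof -
  have "bounded_linear (\<lambda>\<nu>. cinner \<nu> \<eta> *\<^sub>C \<xi>)"
  proof (rule bounded_linear_intro)
    fix x y :: 'a and r :: real
    show "cinner (x + y) \<eta> *\<^sub>C \<xi> = cinner x \<eta> *\<^sub>C \<xi> + cinner y \<eta> *\<^sub>C \<xi>"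
      by (simp add: cinner_add_left scaleC_add_left)
    show "cinner (r *\<^sub>R x) \<eta> *\<^sub>C \<xi> = r *\<^sub>R cinner x \<eta> *\<^sub>C \<xi>"
      by (simp add: scaleR_scaleC cinner_scaleC_left scaleC_scaleC)
    show "norm (cinner x \<eta> *\<^sub>C \<xi>) \<le> norm x * (norm \<eta> * norm \<xi>)"
      using cinner_Cauchy_Schwarz[of x \<eta>]
      by (simp add: norm_scaleC mult.assoc[symmetric] mult_right_mono)
  qed
  then show ?thesis by (simp add: rank_one_def bounded_linear_Blinfun_apply)
qed

text \<open>The zero operator satisfies \<open>eB(H)e = \<complex>e\<close> as well and has to be excluded.\<close>

definition minimal_projection :: "('h :: chilbert_space \<Rightarrow>\<^sub>L 'h) \<Rightarrow> bool" where
  "minimal_projection e \<longleftrightarrow>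
     e \<in> compact_operators \<and> is_adjoint e e \<and> e o\<^sub>L e = e \<and> e \<noteq> 0 \<and>
     {e o\<^sub>L T o\<^sub>L e | T. T \<in> bounded_operators} = {a *\<^sub>C e | a. True}"

section \<open>Hilbert modules over the compact operators\<close>

text \<open>The algebra \<open>K(H)\<close> is the set \<^const>\<open>compact_operators\<close>, so the values of the action \<open>act\<close>
  at operators outside this set are irrelevant. Completeness is part of the sort of \<open>'e\<close>, whose
  norm is tied to the inner product \<open>ip\<close> by \<open>norm_eq\<close>.\<close>

locale hilbert_K_module =
  fixes act :: "('h :: chilbert_space \<Rightarrow>\<^sub>L 'h) \<Rightarrow> 'e :: {complex_normed_vector, banach} \<Rightarrow> 'e"
    and ip :: "'e \<Rightarrow> 'e \<Rightarrow> ('h \<Rightarrow>\<^sub>L 'h)"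
  assumes act_add_left: "\<lbrakk>S \<in> compact_operators; T \<in> compact_operators\<rbrakk>
      \<Longrightarrow> act (S + T) x = act S x + act T x"
    and act_add_right: "T \<in> compact_operators \<Longrightarrow> act T (x + y) = act T x + act T y"
    and act_act: "\<lbrakk>S \<in> compact_operators; T \<in> compact_operators\<rbrakk>
      \<Longrightarrow> act (S o\<^sub>L T) x = act S (act T x)"
    and act_scaleC_left: "T \<in> compact_operators \<Longrightarrow> act (a *\<^sub>C T) x = a *\<^sub>C act T x"
    and act_scaleC_right: "T \<in> compact_operators \<Longrightarrow> act T (a *\<^sub>C x) = a *\<^sub>C act T x"
    and ip_compact: "ip x y \<in> compact_operators"
    and ip_add_left: "ip (x + y) z = ip x z + ip y z"
    and ip_scaleC_left: "ip (a *\<^sub>C x) y = a *\<^sub>C ip x y"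
    and ip_add_right: "ip x (y + z) = ip x y + ip x z"
    and ip_scaleC_right: "ip x (a *\<^sub>C y) = cnj a *\<^sub>C ip x y"
    and ip_act: "T \<in> compact_operators \<Longrightarrow> ip (act T x) y = T o\<^sub>L ip x y"
    and ip_adjoint: "is_adjoint (ip y x) (ip x y)"
    and ip_positive: "positive_operator (ip x x)"
    and ip_eq_0_iff: "ip x x = 0 \<longleftrightarrow> x = 0"
    and norm_eq: "norm x = sqrt (norm (ip x x))"

definition basic :: "('e \<Rightarrow> 'e \<Rightarrow> ('h :: chilbert_space \<Rightarrow>\<^sub>L 'h)) \<Rightarrow> 'e \<Rightarrow> bool" where
  "basic ip x \<longleftrightarrow> minimal_projection (ip x x)"

definition theta :: "(('h :: chilbert_space \<Rightarrow>\<^sub>L 'h) \<Rightarrow> 'e :: complex_normed_vector \<Rightarrow> 'e) \<Rightarrow>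
    ('e \<Rightarrow> 'e \<Rightarrow> ('h \<Rightarrow>\<^sub>L 'h)) \<Rightarrow> 'e \<Rightarrow> 'e \<Rightarrow> 'e \<Rightarrow>\<^sub>L 'e" where
  "theta act ip x y = Blinfun (\<lambda>z. act (ip z y) x)"

definition adjointable :: "('e \<Rightarrow> 'e \<Rightarrow> ('h :: chilbert_space \<Rightarrow>\<^sub>L 'h)) \<Rightarrow>
    ('e :: complex_normed_vector \<Rightarrow>\<^sub>L 'e) set" where
  "adjointable ip = {T. \<exists>S. \<forall>x y. ip (blinfun_apply T x) y = ip x (blinfun_apply S y)}"

text \<open>The following shows that the argument of \<^const>\<open>Blinfun\<close> in the definition of \<^const>\<open>theta\<close> is
  indeed a bounded operator, and that \<^const>\<open>theta\<close> yields adjointable maps. The norm of the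
  space of adjointable maps is the operator norm inherited from \<open>'e \<Rightarrow>\<^sub>L 'e\<close>.\<close>

context hilbert_K_module
begin

lemma norm_ip_self: "norm (ip x x) = (norm x)\<^sup>2"
  by (simp add: norm_eq)

lemma ip_move: "cinner (ip x y \<xi>) \<eta> = cinner \<xi> (ip y x \<eta>)"
  using ip_adjoint[of x y] by (simp add: is_adjoint_def)

lemma norm_ip_le: "norm (ip x y) \<le> norm x * norm y"
proof (rule norm_blinfun_bound)
  fix \<xi> :: 'h
  define v where "v = blinfun_apply (ip x y) \<xi>"
  define x' where "x' = act (ip y x) x"
  define f where "f = (\<lambda>x y. cinner (blinfun_apply (ip x y) \<xi>) \<xi>)"
  have CS: "(cmod (f x y))\<^sup>2 \<le> Re (f x x) * Re (f y y)" for x y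
  proof (rule semi_inner_Cauchy_Schwarz)
    show "f (x + y) z = f x z + f y z" for x y z
      by (simp add: f_def ip_add_left blinfun.add_left cinner_add_left)
    show "f (a *\<^sub>C x) y = a * f x y" for a x y
      by (simp add: f_def ip_scaleC_left scaleC_blinfun.rep_eq cinner_scaleC_left)
    show "f x y = cnj (f y x)" for x y
      unfolding f_def by (subst ip_move) (rule cinner_commute)
    show "0 \<le> Re (f x x)" for x
      using ip_positive[of x]
      by (auto simp: f_def positive_operator_def complex_nonneg_Reals_iff)
  qed
  have "f x' y = cinner (ip y x v) \<xi>"
    by (simp add: f_def x'_def v_def ip_act[OF ip_compact])
  also have "\<dots> = of_real ((norm v)\<^sup>2)"
    by (subst ip_move) (simp only: v_def[symmetric] cinner_self)
  finally have 1: "cmod (f x' y) = (norm v)\<^sup>2" by (simp add: norm_power)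
  have "f x' x' = cinner (ip y x (ip x x' \<xi>)) \<xi>"
    by (simp add: f_def x'_def ip_act[OF ip_compact])
  also have "\<dots> = cinner \<xi> (ip x' x v)"
    by (simp only: ip_move v_def[symmetric])
  also have "\<dots> = cinner \<xi> (ip y x (ip x x v))"
    by (simp add: x'_def ip_act[OF ip_compact])
  also have "\<dots> = cinner v (ip x x v)"
    unfolding v_def by (rule ip_move[symmetric])
  finally have "Re (f x' x') \<le> cmod (cinner v (ip x x v))"
    using complex_Re_le_cmod by metis
  also have "\<dots> \<le> norm v * norm (ip x x v)" by (rule cinner_Cauchy_Schwarz)
  also have "\<dots> \<le> norm v * ((norm x)\<^sup>2 * norm v)"
    using norm_blinfun[of "ip x x" v] by (intro mult_left_mono) (auto simp: norm_ip_self)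
  finally have 2: "Re (f x' x') \<le> (norm x * norm v)\<^sup>2"
    by (simp add: power2_eq_square mult_ac)
  have "Re (f y y) \<le> cmod (f y y)" by (rule complex_Re_le_cmod)
  also have "\<dots> \<le> norm (ip y y \<xi>) * norm \<xi>" unfolding f_def by (rule cinner_Cauchy_Schwarz)
  also have "\<dots> \<le> ((norm y)\<^sup>2 * norm \<xi>) * norm \<xi>"
    using norm_blinfun[of "ip y y" \<xi>] by (intro mult_right_mono) (auto simp: norm_ip_self)
  finally have 3: "Re (f y y) \<le> (norm y * norm \<xi>)\<^sup>2"
    by (simp add: power2_eq_square mult_ac)
  have pos: "0 \<le> Re (f y y)"
    using ip_positive[of y]
    by (auto simp: f_def positive_operator_def complex_nonneg_Reals_iff)
  have "((norm v)\<^sup>2)\<^sup>2 \<le> Re (f x' x') * Re (f y y)" using CS[of x' y] 1 by simp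
  also have "\<dots> \<le> (norm x * norm v)\<^sup>2 * (norm y * norm \<xi>)\<^sup>2"
    using 2 3 pos by (intro mult_mono) auto
  also have "\<dots> = (norm v * (norm x * norm y * norm \<xi>))\<^sup>2"
    by (simp add: power_mult_distrib)
  finally have "(norm v)\<^sup>2 \<le> norm v * (norm x * norm y * norm \<xi>)"
    by (rule power2_le_imp_le) simp
  then have "norm v \<le> norm x * norm y * norm \<xi>"
    by (cases "v = 0") (auto simp: power2_eq_square)
  then show "norm (blinfun_apply (ip x y) \<xi>) \<le> norm x * norm y * norm \<xi>"
    by (simp add: v_def)
qed simp

lemma norm_act_le:
  assumes "T \<in> compact_operators"
  shows "norm (act T x) \<le> norm T * norm x"
proof -
  have "(norm (act T x))\<^sup>2 = norm (T o\<^sub>L ip x (act T x))"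
    by (simp add: norm_ip_self[symmetric] ip_act[OF assms])
  also have "\<dots> \<le> norm T * norm (ip x (act T x))" by (rule norm_blinfun_compose)
  also have "\<dots> \<le> norm T * (norm x * norm (act T x))"
    by (intro mult_left_mono norm_ip_le) simp
  finally show ?thesis
    by (cases "act T x = 0") (auto simp: power2_eq_square)
qed

lemma theta_apply: "blinfun_apply (theta act ip x y) z = act (ip z y) x"
proof -
  have "bounded_linear (\<lambda>z. act (ip z y) x)"
  proof (rule bounded_linear_intro)
    fix z w :: 'e and r :: real
    show "act (ip (z + w) y) x = act (ip z y) x + act (ip w y) x"
      by (simp add: ip_add_left act_add_left ip_compact)
    show "act (ip (r *\<^sub>R z) y) x = r *\<^sub>R act (ip z y) x"
      by (simp add: scaleR_scaleC ip_scaleC_left act_scaleC_left ip_compact)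
    have "norm (act (ip z y) x) \<le> norm (ip z y) * norm x"
      by (intro norm_act_le ip_compact)
    also have "\<dots> \<le> norm z * norm y * norm x"
      by (intro mult_right_mono norm_ip_le) simp
    finally show "norm (act (ip z y) x) \<le> norm z * (norm y * norm x)"
      by (simp add: mult.assoc)
  qed
  then show ?thesis by (simp add: theta_def bounded_linear_Blinfun_apply)
qed

lemma theta_adjointable: "theta act ip x y \<in> adjointable ip"
proof -
  have eqI: "S = T" if "\<And>\<xi> \<eta>. cinner (blinfun_apply S \<xi>) \<eta> = cinner (blinfun_apply T \<xi>) \<eta>"
    for S T :: "'h \<Rightarrow>\<^sub>L 'h"
  proof (rule blinfun_eqI)
    fix \<xi>
    have "inner (S \<xi> - T \<xi>) (S \<xi> - T \<xi>) = 0"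
      using arg_cong[OF that, of Re] by (simp add: inner_diff_left Re_cinner)
    then show "S \<xi> = T \<xi>" by simp
  qed
  have "ip (theta act ip x y z) w = ip z (theta act ip y x w)" for z w
  proof (rule eqI)
    fix \<xi> \<eta>
    have "cinner (ip z (theta act ip y x w) \<xi>) \<eta> = cinner \<xi> (ip w x (ip y z \<eta>))"
      by (subst ip_move) (simp add: theta_apply ip_act[OF ip_compact])
    also have "\<dots> = cinner (ip (theta act ip x y z) w \<xi>) \<eta>"
      by (simp add: theta_apply ip_act[OF ip_compact] ip_move)
    finally show "cinner (ip (theta act ip x y z) w \<xi>) \<eta>
        = cinner (ip z (theta act ip y x w) \<xi>) \<eta>" ..
  qed
  then show ?thesis unfolding adjointable_def by blast
qed

end

end

theory Submission
  imports Defs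
begin

text \<open>Write \<open>\<langle>x, y\<rangle>\<close> for \<open>ip x y\<close>, \<open>\<theta>\<^sub>x\<close> for \<open>theta act ip x x\<close>, and let \<open>a = \<parallel>x\<parallel>\<close>, \<open>b = \<parallel>y\<parallel>\<close>.

  For nonzero \<open>x\<close> and \<open>y\<close>, the norm equality \<open>\<parallel>\<langle>x, y\<rangle>\<parallel> = a b\<close> implies the other two conditions
  because it produces a basic vector \<open>z\<close> that is an eigenvector of \<open>\<theta>\<^sub>x\<close> for \<open>a\<^sup>2\<close> and of \<open>\<theta>\<^sub>y\<close> for \<open>b\<^sup>2\<close>
  (\<open>common_basic_eigenvector\<close>). This is where compactness enters: the compact operator
  \<open>\<langle>x, y\<rangle>\<close> attains its norm at a unit vector \<open>\<xi>\<close> (\<open>compact_operator_attains_norm\<close>). With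
  \<open>\<eta> = \<langle>x, y\<rangle> \<xi> / (a b)\<close>, the vectors \<open>x\<^sub>1 = (\<xi> \<otimes> \<eta>) x\<close> and \<open>y\<^sub>1 = (\<xi> \<otimes> \<xi>) y\<close> have inner
  product \<open>a b (\<xi> \<otimes> \<xi>)\<close> and norms at most \<open>a\<close> and \<open>b\<close>; equality in the Cauchy-Schwarz
  inequality makes them parallel, and \<open>z = x\<^sub>1 / a = y\<^sub>1 / b\<close> (\<open>act_rank_one_aligned\<close>). Then
  \<open>\<theta>\<^sub>x + \<theta>\<^sub>y\<close> has the eigenvalue \<open>a\<^sup>2 + b\<^sup>2 = \<parallel>\<theta>\<^sub>x\<parallel> + \<parallel>\<theta>\<^sub>y\<parallel>\<close>, so the two operators are parallel with
  \<open>\<lambda> = 1\<close>; and since \<open>\<langle>z, x\<rangle> \<langle>x, y\<rangle> \<langle>y, z\<rangle> = \<langle>\<theta>\<^sub>x z, \<theta>\<^sub>y z\<rangle> = a\<^sup>2 b\<^sup>2 (\<xi> \<otimes> \<xi>)\<close>, the constant sequence \<open>z\<close>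
  satisfies the limit condition.

  Both converses are norm estimates that leave \<open>a b \<le> \<parallel>\<langle>x, y\<rangle>\<parallel>\<close> after division by \<open>a b\<close>; the
  reverse inequality is that of Cauchy and Schwarz. For parallelism one expands the
  square of the norm of \<open>\<theta>\<^sub>x z + \<lambda> \<theta>\<^sub>y z\<close>: its mixed term is controlled by
  \<open>\<langle>z, x\<rangle> \<langle>x, y\<rangle> \<langle>y, z\<rangle>\<close>, hence by \<open>a b \<parallel>\<langle>x, y\<rangle>\<parallel> \<parallel>z\<parallel>\<^sup>2\<close> (\<open>norm_theta_add_square_le\<close>). For the limit
  condition one bounds each member of the sequence by \<open>a b \<parallel>\<langle>x, y\<rangle>\<parallel>\<close>.\<close>

section \<open>Operators attaining their norm\<close>

lemma inner_adjoint:
  assumes "is_adjoint S T"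
  shows "inner (blinfun_apply S \<xi>) \<eta> = inner \<xi> (blinfun_apply T \<eta>)"
  using assms by (simp add: is_adjoint_def flip: Re_cinner)

lemma norm_adjoint_le:
  assumes "is_adjoint S T"
  shows "norm S \<le> norm T"
proof (rule norm_blinfun_bound)
  fix \<xi>
  have "(norm (S \<xi>))\<^sup>2 = inner \<xi> (T (S \<xi>))"
    by (simp add: power2_norm_eq_inner inner_adjoint[OF assms])
  also have "\<dots> \<le> norm \<xi> * norm (T (S \<xi>))" by (rule norm_cauchy_schwarz)
  also have "\<dots> \<le> norm \<xi> * (norm T * norm (S \<xi>))"
    by (intro mult_left_mono norm_blinfun) simp
  finally show "norm (S \<xi>) \<le> norm T * norm \<xi>"
    by (cases "S \<xi> = 0") (auto simp: power2_eq_square mult_ac)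
qed simp

lemma blinfun_nearly_attains_norm:
  fixes T :: "'a :: real_normed_vector \<Rightarrow>\<^sub>L 'b :: real_normed_vector"
  assumes "0 < \<epsilon>"
  shows "\<exists>u. norm u \<le> 1 \<and> norm T - \<epsilon> \<le> norm (blinfun_apply T u)"
proof (rule ccontr)
  assume "\<not> ?thesis"
  then have *: "norm (blinfun_apply T u) < norm T - \<epsilon>" if "norm u \<le> 1" for u
    using that by fastforce
  have "norm T \<le> norm T - \<epsilon>"
  proof (rule norm_blinfun_bound)
    show "0 \<le> norm T - \<epsilon>" using *[of 0] by simp
    show "norm (blinfun_apply T v) \<le> (norm T - \<epsilon>) * norm v" for v
    proof (cases "v = 0")
      case False
      then have "norm (blinfun_apply T (v /\<^sub>R norm v)) < norm T - \<epsilon>" by (intro *) simp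
      then show ?thesis using False by (simp add: blinfun.scaleR_right field_simps)
    qed simp
  qed
  then show False using assms by simp
qed

text \<open>A unit vector at which \<open>T\<close> attains its norm is an eigenvector of \<open>T\<^sup>* T\<close>. Such a vector
  exists because a sequence \<open>u\<^sub>n\<close> in the unit ball with \<open>\<parallel>T u\<^sub>n\<parallel> \<longrightarrow> \<parallel>T\<parallel>\<close> satisfies
  \<open>T\<^sup>* T u\<^sub>n - \<parallel>T\<parallel>\<^sup>2 u\<^sub>n \<longrightarrow> 0\<close>. Along a subsequence for which \<open>T u\<^sub>n\<close> converges, \<open>T\<^sup>* T u\<^sub>n\<close> converges as well,
  and hence so does \<open>u\<^sub>n\<close> itself.\<close>

lemma compact_operator_attains_norm:
  fixes S T :: "'h :: chilbert_space \<Rightarrow>\<^sub>L 'h"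
  assumes "T \<in> compact_operators" and adj: "is_adjoint S T" and "T \<noteq> 0"
  obtains \<xi> where "norm \<xi> = 1" and "S (T \<xi>) = (norm T)\<^sup>2 *\<^sub>R \<xi>"
proof -
  define t where "t = norm T"
  have t: "0 < t" using \<open>T \<noteq> 0\<close> by (simp add: t_def)
  have "\<forall>n. \<exists>u. norm u \<le> 1 \<and> t - 1 / real (Suc n) \<le> norm (blinfun_apply T u)"
    unfolding t_def by (intro allI blinfun_nearly_attains_norm) simp
  then obtain u :: "nat \<Rightarrow> 'h" where u1: "\<And>n. norm (u n) \<le> 1"
    and u2: "\<And>n. t - 1 / real (Suc n) \<le> norm (T (u n))"
    by metis
  have u3: "norm (T (u n)) \<le> t" for n
    using norm_blinfun[of T "u n"] mult_left_mono[OF u1[of n], of "norm T"] by (simp add: t_def)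
  have lim: "(\<lambda>n. norm (T (u n))) \<longlonglongrightarrow> t"
  proof (rule tendsto_sandwich)
    show "(\<lambda>n. t - 1 / real (Suc n)) \<longlonglongrightarrow> t"
      using tendsto_diff[OF tendsto_const[of t] LIMSEQ_inverse_real_of_nat] 
      by (simp add: inverse_eq_divide)
  qed (use u2 u3 in auto)
  have "seq_compact (closure (T ` cball 0 1))"
    using assms(1) by (simp add: compact_operators_def compact_imp_seq_compact)
  moreover have "\<forall>n. T (u n) \<in> closure (T ` cball 0 1)"
    using u1 by (intro allI closure_subset[THEN subsetD]) auto
  ultimately obtain v r where r: "strict_mono (r :: nat \<Rightarrow> nat)"
    and v: "((\<lambda>n. T (u n)) \<circ> r) \<longlonglongrightarrow> v"
    by (rule seq_compactE)
  then have Tv: "(\<lambda>n. T (u (r n))) \<longlonglongrightarrow> v" by (simp add: o_def)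
  have limr: "(\<lambda>n. norm (T (u (r n)))) \<longlonglongrightarrow> t"
    using LIMSEQ_subseq_LIMSEQ[OF lim r] by (simp add: o_def)
  have nv: "norm v = t"
    using LIMSEQ_unique[OF tendsto_norm[OF Tv] limr] .
  have STv: "(\<lambda>n. S (T (u (r n)))) \<longlonglongrightarrow> S v"
    by (intro blinfun.tendsto tendsto_const Tv)
  \<comment> \<open>The right-hand side tends to zero: the \<open>u n\<close> are approximate eigenvectors.\<close>
  have est: "norm (S (T (u n)) - t\<^sup>2 *\<^sub>R u n) \<le> sqrt (t\<^sup>2 * (t\<^sup>2 - (norm (T (u n)))\<^sup>2))" for n
  proof -
    let ?w = "T (u n)"
    have "norm (S ?w) \<le> t * norm ?w"
      using norm_blinfun[of S ?w] norm_adjoint_le[OF adj]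
        mult_right_mono[of "norm S" t "norm ?w"]
      by (simp add: t_def)
    then have 1: "(norm (S ?w))\<^sup>2 \<le> t\<^sup>2 * (norm ?w)\<^sup>2"
      using power_mono[of "norm (S ?w)" "t * norm ?w" 2] by (simp add: power_mult_distrib)
    have 2: "t\<^sup>2 * t\<^sup>2 * (norm (u n))\<^sup>2 \<le> t\<^sup>2 * t\<^sup>2 * 1"
      using u1[of n] by (intro mult_left_mono) (auto simp: power_le_one)
    have "(norm (S ?w - t\<^sup>2 *\<^sub>R u n))\<^sup>2
        = (norm (S ?w))\<^sup>2 - 2 * t\<^sup>2 * (norm ?w)\<^sup>2 + t\<^sup>2 * t\<^sup>2 * (norm (u n))\<^sup>2"
      by (simp add: power2_norm_eq_inner inner_diff_left inner_diff_right inner_adjoint[OF adj]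
          inner_commute[of "u n" "S ?w"] algebra_simps)
    also have "\<dots> \<le> t\<^sup>2 * (t\<^sup>2 - (norm ?w)\<^sup>2)"
      using 1 2 by (simp add: algebra_simps)
    finally show ?thesis by (rule real_le_rsqrt)
  qed
  have "(\<lambda>n. sqrt (t\<^sup>2 * (t\<^sup>2 - (norm (T (u (r n))))\<^sup>2))) \<longlonglongrightarrow> sqrt (t\<^sup>2 * (t\<^sup>2 - t\<^sup>2))"
    by (intro tendsto_intros limr)
  then have "(\<lambda>n. S (T (u (r n))) - t\<^sup>2 *\<^sub>R u (r n)) \<longlonglongrightarrow> 0"
    by (intro Lim_null_comparison[OF always_eventually[OF allI[OF est]]]) simp
  from tendsto_diff[OF STv this] have "(\<lambda>n. t\<^sup>2 *\<^sub>R u (r n)) \<longlonglongrightarrow> S v" by simp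
  from tendsto_scaleR[OF tendsto_const[of "inverse (t\<^sup>2)"] this]
  have ulim: "(\<lambda>n. u (r n)) \<longlonglongrightarrow> S v /\<^sub>R t\<^sup>2" (is "_ \<longlonglongrightarrow> ?\<xi>") using t by simp
  have T\<xi>: "T ?\<xi> = v"
    by (rule LIMSEQ_unique[OF _ Tv]) (intro blinfun.tendsto tendsto_const ulim)
  have "norm ?\<xi> \<le> 1"
    using u1 by (intro Lim_norm_ubound[OF _ ulim]) auto
  moreover have "t \<le> t * norm ?\<xi>"
    using norm_blinfun[of T ?\<xi>] unfolding T\<xi> nv by (simp only: t_def)
  then have "1 \<le> norm ?\<xi>" using t by simp
  ultimately have "norm ?\<xi> = 1" by simp
  moreover have "S (T ?\<xi>) = (norm T)\<^sup>2 *\<^sub>R ?\<xi>"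
    unfolding T\<xi> using t by (simp add: t_def)
  ultimately show thesis by (rule that)
qed

text \<open>The square of \<open>\<parallel>T \<eta> - \<parallel>T\<parallel> \<eta>\<parallel>\<close> is \<open>\<parallel>T \<eta>\<parallel>\<^sup>2 - 2 \<parallel>T\<parallel> [T \<eta>, \<eta>] + \<parallel>T\<parallel>\<^sup>2\<close>, which the hypotheses make
  nonpositive.\<close>

lemma eigenvector_if_maximal:
  fixes T :: "'a :: real_inner \<Rightarrow>\<^sub>L 'a"
  assumes "norm \<eta> = 1" and "norm T \<le> inner (blinfun_apply T \<eta>) \<eta>"
  shows "blinfun_apply T \<eta> = norm T *\<^sub>R \<eta>"
proof -
  have "(norm (T \<eta>))\<^sup>2 \<le> (norm T)\<^sup>2"
    using norm_blinfun[of T \<eta>] assms(1) by (intro power_mono) auto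
  moreover have "norm T * norm T \<le> norm T * inner (T \<eta>) \<eta>"
    using assms(2) by (intro mult_left_mono) auto
  moreover have "inner \<eta> \<eta> = 1" using assms(1) by (simp flip: power2_norm_eq_inner)
  then have "(norm (T \<eta> - norm T *\<^sub>R \<eta>))\<^sup>2
      = (norm (T \<eta>))\<^sup>2 - 2 * (norm T * inner (T \<eta>) \<eta>) + (norm T)\<^sup>2"
    unfolding power2_norm_eq_inner
    by (simp add: inner_diff_left inner_diff_right inner_commute[of \<eta> "T \<eta>"]
        power2_eq_square algebra_simps)
  ultimately have "(norm (T \<eta> - norm T *\<^sub>R \<eta>))\<^sup>2 \<le> 0"
    by (simp add: power2_eq_square)
  then show ?thesis by simp
qed

section \<open>Rank-one operators\<close>

lemma cinner_unit: "norm \<xi> = 1 \<Longrightarrow> cinner \<xi> \<xi> = 1"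
  by (simp add: cinner_self)

lemma bounded_linear_scaleC_left:
  "bounded_linear (\<lambda>c. c *\<^sub>C (x :: 'a :: complex_normed_vector))"
  by (rule bounded_linear_intro[where K = "norm x"])
    (auto simp: scaleC_add_left scaleR_scaleC scaleC_scaleC norm_scaleC scaleR_conv_of_real)

lemma norm_rank_one_le: "norm (\<xi> \<otimes>\<^sub>H \<eta>) \<le> norm \<xi> * norm \<eta>"
  using mult_right_mono[OF cinner_Cauchy_Schwarz, of "norm \<xi>"]
  by (intro norm_blinfun_bound) (auto simp: norm_scaleC mult_ac)

lemma rank_one_scaleC_right: "\<xi> \<otimes>\<^sub>H (a *\<^sub>C \<eta>) = cnj a *\<^sub>C (\<xi> \<otimes>\<^sub>H \<eta>)"
  by (rule blinfun_eqI) (simp add: scaleC_blinfun.rep_eq scaleC_scaleC cinner_scaleC_right)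

lemma rank_one_compact: "\<xi> \<otimes>\<^sub>H \<eta> \<in> compact_operators"
proof -
  have "(\<xi> \<otimes>\<^sub>H \<eta>) ` cball 0 1 \<subseteq> (\<lambda>c. c *\<^sub>C \<xi>) ` cball 0 (norm \<eta>)"
  proof
    fix v assume "v \<in> (\<xi> \<otimes>\<^sub>H \<eta>) ` cball 0 1"
    then obtain \<nu> where "norm \<nu> \<le> 1" "v = cinner \<nu> \<eta> *\<^sub>C \<xi>" by auto
    moreover have "cmod (cinner \<nu> \<eta>) \<le> norm \<eta>"
      using cinner_Cauchy_Schwarz[of \<nu> \<eta>] mult_right_mono[OF \<open>norm \<nu> \<le> 1\<close>, of "norm \<eta>"] by simp
    ultimately show "v \<in> (\<lambda>c. c *\<^sub>C \<xi>) ` cball 0 (norm \<eta>)" by auto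
  qed
  moreover have "compact ((\<lambda>c. c *\<^sub>C \<xi>) ` cball 0 (norm \<eta>))"
    by (intro compact_continuous_image compact_cball linear_continuous_on
        bounded_linear_scaleC_left)
  ultimately have "compact (closure ((\<xi> \<otimes>\<^sub>H \<eta>) ` cball 0 1))"
    by (metis closed_closure closure_minimal compact_Int_closed compact_imp_closed inf.absorb2)
  then show ?thesis
    by (simp add: compact_operators_def bounded_operators_def cinner_scaleC_left scaleC_scaleC)
qed

text \<open>The corner \<open>e B(H) e\<close> of \<open>e = \<xi> \<otimes> \<xi>\<close> is one-dimensional since \<open>e T e = [T \<xi>, \<xi>] e\<close>.\<close>

lemma minimal_projection_rank_one:
  fixes \<xi> :: "'h :: chilbert_space"
  assumes "norm \<xi> = 1"
  shows "minimal_projection (\<xi> \<otimes>\<^sub>H \<xi>)"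
proof -
  let ?e = "\<xi> \<otimes>\<^sub>H \<xi>"
  note [simp] = cinner_unit[OF assms]
  have "is_adjoint ?e ?e"
    by (auto simp: is_adjoint_def cinner_scaleC_left cinner_scaleC_right simp flip: cinner_commute)
  moreover have "?e o\<^sub>L ?e = ?e"
    by (rule blinfun_eqI) (simp add: cinner_scaleC_left)
  moreover have "?e \<noteq> 0"
  proof
    assume "?e = 0"
    then have "?e \<xi> = 0" by simp
    then show False using assms by (simp add: scaleC_one)
  qed
  moreover have corner: "?e o\<^sub>L T o\<^sub>L ?e = cinner (T \<xi>) \<xi> *\<^sub>C ?e" if "T \<in> bounded_operators" for T
    using that
    by (intro blinfun_eqI)
      (simp add: bounded_operators_def scaleC_blinfun.rep_eq cinner_scaleC_left scaleC_scaleC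
        mult.commute)
  moreover have "\<exists>T \<in> bounded_operators. a *\<^sub>C ?e = ?e o\<^sub>L T o\<^sub>L ?e" for a
  proof (intro bexI)
    show "a *\<^sub>C id_blinfun \<in> (bounded_operators :: ('h \<Rightarrow>\<^sub>L 'h) set)"
      by (simp add: bounded_operators_def scaleC_blinfun.rep_eq scaleC_scaleC mult.commute)
    then show "a *\<^sub>C ?e = ?e o\<^sub>L (a *\<^sub>C id_blinfun) o\<^sub>L ?e"
      by (simp add: corner scaleC_blinfun.rep_eq cinner_scaleC_left)
  qed
  then have "{?e o\<^sub>L T o\<^sub>L ?e | T. T \<in> bounded_operators} = {a *\<^sub>C ?e | a. True}"
    using corner by blast
  ultimately show ?thesis
    using rank_one_compact[of \<xi> \<xi>] by (simp add: minimal_projection_def)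
qed

section \<open>Basic common eigenvectors\<close>

context hilbert_K_module
begin

lemma norm_ip_commute: "norm (ip x y) = norm (ip y x)"
  using norm_adjoint_le[OF ip_adjoint[of x y]] norm_adjoint_le[OF ip_adjoint[of y x]] by simp

lemma ip_flip_rank_one:
  assumes "ip z v = \<xi> \<otimes>\<^sub>H \<eta>"
  shows "ip v z = \<eta> \<otimes>\<^sub>H \<xi>"
proof (rule blinfun_eqI)
  fix \<nu>
  have "inner (ip v z \<nu> - (\<eta> \<otimes>\<^sub>H \<xi>) \<nu>) \<mu> = 0" for \<mu>
  proof -
    have "cinner (ip v z \<nu>) \<mu> = cinner \<nu> (cinner \<mu> \<eta> *\<^sub>C \<xi>)"
      by (subst ip_move) (simp add: assms)
    also have "\<dots> = cinner ((\<eta> \<otimes>\<^sub>H \<xi>) \<nu>) \<mu>"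
      by (simp add: cinner_scaleC_right cinner_scaleC_left flip: cinner_commute)
    finally have "Re (cinner (ip v z \<nu>) \<mu>) = Re (cinner ((\<eta> \<otimes>\<^sub>H \<xi>) \<nu>) \<mu>)" by simp
    then show ?thesis by (simp only: Re_cinner inner_diff_left diff_self)
  qed
  from this[of "ip v z \<nu> - (\<eta> \<otimes>\<^sub>H \<xi>) \<nu>"]
  show "ip v z \<nu> = (\<eta> \<otimes>\<^sub>H \<xi>) \<nu>" by simp
qed

lemma ip_act_rank_one: "ip (act (\<zeta> \<otimes>\<^sub>H \<eta>) x) v = \<zeta> \<otimes>\<^sub>H ip v x \<eta>"
  by (rule blinfun_eqI) (simp add: ip_act[OF rank_one_compact] ip_move)

lemma ip_diff_left: "ip (x - y) z = ip x z - ip y z"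
  using ip_add_left[of "x - y" y z] by (simp add: algebra_simps)

lemma ip_diff_right: "ip x (y - z) = ip x y - ip x z"
  using ip_add_right[of x "y - z" z] by (simp add: algebra_simps)

text \<open>\<open>\<theta>\<^sub>x\<close> is module linear and maps \<open>x\<close> to \<open>\<langle>x, x\<rangle> x\<close>, so it maps \<open>(\<zeta> \<otimes> \<eta>) x\<close> to
  \<open>(\<zeta> \<otimes> \<langle>x, x\<rangle> \<eta>) x\<close>: eigenvectors of the operator \<open>\<langle>x, x\<rangle>\<close> become eigenvectors of \<open>\<theta>\<^sub>x\<close>.\<close>

lemma theta_act_eigenvector:
  assumes "ip x x \<eta> = (norm x)\<^sup>2 *\<^sub>R \<eta>"
  shows "theta act ip x x (act (\<zeta> \<otimes>\<^sub>H \<eta>) x)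
    = complex_of_real ((norm x)\<^sup>2) *\<^sub>C act (\<zeta> \<otimes>\<^sub>H \<eta>) x"
  by (simp add: theta_apply ip_act_rank_one assms scaleR_scaleC rank_one_scaleC_right
      act_scaleC_left rank_one_compact del: of_real_power)

text \<open>The case of equality in the Cauchy-Schwarz inequality. All inner products of
  \<open>x\<^sub>1 = (\<xi> \<otimes> \<eta>) x\<close> and \<open>y\<^sub>1 = (\<xi> \<otimes> \<xi>) y\<close> are real multiples of \<open>\<xi> \<otimes> \<xi>\<close>, with coefficients
  \<open>p = [\<langle>x, x\<rangle> \<eta>, \<eta>] \<le> a\<^sup>2\<close>, \<open>q = [\<langle>y, y\<rangle> \<xi>, \<xi>] \<le> b\<^sup>2\<close> and, for the mixed ones, \<open>a b\<close>, where \<open>a = \<parallel>x\<parallel>\<close> and \<open>b = \<parallel>y\<parallel>\<close>.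
  Positivity of the inner square of \<open>b x\<^sub>1 - a y\<^sub>1\<close>, that is \<open>b\<^sup>2 p + a\<^sup>2 q \<ge> 2 a\<^sup>2 b\<^sup>2\<close>, forces \<open>p = a\<^sup>2\<close>, \<open>q = b\<^sup>2\<close> and
  \<open>b x\<^sub>1 = a y\<^sub>1\<close>; the values of \<open>p\<close> and \<open>q\<close> are the maximal ones, so \<open>\<eta>\<close> and \<open>\<xi>\<close> are eigenvectors.\<close>

lemma act_rank_one_aligned:
  assumes unit: "norm \<xi> = 1" "norm \<eta> = 1"
    and pos: "0 < norm x" "0 < norm y"
    and yx: "ip y x \<eta> = (norm x * norm y) *\<^sub>R \<xi>"
  shows "norm y *\<^sub>R act (\<xi> \<otimes>\<^sub>H \<eta>) x = norm x *\<^sub>R act (\<xi> \<otimes>\<^sub>H \<xi>) y"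
    and "ip x x \<eta> = (norm x)\<^sup>2 *\<^sub>R \<eta>"
    and "ip y y \<xi> = (norm y)\<^sup>2 *\<^sub>R \<xi>"
proof -
  let ?e = "\<xi> \<otimes>\<^sub>H \<xi>"
  define a where "a = norm x"
  define b where "b = norm y"
  define x1 where "x1 = act (\<xi> \<otimes>\<^sub>H \<eta>) x"
  define y1 where "y1 = act ?e y"
  define p where "p = inner (ip x x \<eta>) \<eta>"
  define q where "q = inner (ip y y \<xi>) \<xi>"
  have ab: "0 < a" "0 < b" using pos by (auto simp: a_def b_def)
  have real: "cinner (ip z z \<nu>) \<nu> = complex_of_real (inner (ip z z \<nu>) \<nu>)" for z \<nu>
    using ip_positive[of z]
    by (intro complex_eqI)
      (auto simp: positive_operator_def complex_nonneg_Reals_iff Re_cinner)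
  have self: "ip (act (\<xi> \<otimes>\<^sub>H \<nu>) z) (act (\<xi> \<otimes>\<^sub>H \<nu>) z) = inner (ip z z \<nu>) \<nu> *\<^sub>R ?e" for z \<nu>
  proof -
    have "ip z (act (\<xi> \<otimes>\<^sub>H \<nu>) z) = ip z z \<nu> \<otimes>\<^sub>H \<xi>"
      by (rule ip_flip_rank_one) (rule ip_act_rank_one)
    then have "ip (act (\<xi> \<otimes>\<^sub>H \<nu>) z) (act (\<xi> \<otimes>\<^sub>H \<nu>) z) = (\<xi> \<otimes>\<^sub>H \<nu>) o\<^sub>L (ip z z \<nu> \<otimes>\<^sub>H \<xi>)"
      by (simp add: ip_act[OF rank_one_compact])
    also have "\<dots> = inner (ip z z \<nu>) \<nu> *\<^sub>R ?e"
      by (rule blinfun_eqI)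
        (simp add: cinner_scaleC_left scaleR_scaleC scaleC_blinfun.rep_eq scaleC_scaleC real
          mult.commute)
    finally show ?thesis .
  qed
  have yx1: "ip y x1 = (a * b) *\<^sub>R ?e"
  proof -
    have "ip y x1 = ip y x \<eta> \<otimes>\<^sub>H \<xi>"
      unfolding x1_def by (rule ip_flip_rank_one) (rule ip_act_rank_one)
    also have "\<dots> = (a * b) *\<^sub>R ?e"
      by (rule blinfun_eqI)
        (simp add: yx a_def b_def scaleR_scaleC scaleC_blinfun.rep_eq scaleC_scaleC mult.commute)
    finally show ?thesis .
  qed
  have y1x1: "ip y1 x1 = (a * b) *\<^sub>R ?e"
    by (rule blinfun_eqI)
      (simp add: y1_def ip_act[OF rank_one_compact] yx1 blinfun.scaleR_left blinfun.scaleR_right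
        cinner_scaleC_left cinner_unit unit)
  have x1y1: "ip x1 y1 = (a * b) *\<^sub>R ?e"
  proof -
    have "ip y1 x1 = \<xi> \<otimes>\<^sub>H (complex_of_real (a * b) *\<^sub>C \<xi>)"
      by (simp only: y1x1 rank_one_scaleC_right complex_cnj_complex_of_real scaleR_scaleC)
    from ip_flip_rank_one[OF this] show ?thesis
      by (intro blinfun_eqI)
        (simp add: scaleR_scaleC scaleC_blinfun.rep_eq scaleC_scaleC mult.commute)
  qed
  have le: "inner (ip z z \<nu>) \<nu> \<le> (norm z)\<^sup>2" if "norm \<nu> = 1" for z \<nu>
    using norm_cauchy_schwarz[of "ip z z \<nu>" \<nu>] norm_blinfun[of "ip z z" \<nu>] that
    by (simp add: norm_ip_self)
  have p: "p \<le> a\<^sup>2" and q: "q \<le> b\<^sup>2"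
    unfolding p_def q_def a_def b_def by (auto intro: le unit)
  define d where "d = b *\<^sub>R x1 - a *\<^sub>R y1"
  define k where "k = b\<^sup>2 * p + a\<^sup>2 * q - 2 * (a\<^sup>2 * b\<^sup>2)"
  have dd: "ip d d = k *\<^sub>R ?e"
  proof -
    have sl: "ip (s *\<^sub>R u) v = s *\<^sub>R ip u v" and sr: "ip u (s *\<^sub>R v) = s *\<^sub>R ip u v" for s u v
      by (simp_all add: scaleR_scaleC ip_scaleC_left ip_scaleC_right)
    have xx: "ip x1 x1 = p *\<^sub>R ?e" and yy: "ip y1 y1 = q *\<^sub>R ?e"
      unfolding x1_def y1_def p_def q_def by (rule self)+
    show ?thesis
      unfolding d_def k_def ip_diff_left ip_diff_right sl sr xx yy x1y1 y1x1
      by (simp add: algebra_simps power2_eq_square flip: scaleR_add_left)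
  qed
  have "0 \<le> inner (ip d d \<xi>) \<xi>"
    using ip_positive[of d]
    by (auto simp: positive_operator_def complex_nonneg_Reals_iff simp flip: Re_cinner)
  also have "inner (ip d d \<xi>) \<xi> = k"
    using unit
    by (simp add: dd blinfun.scaleR_left cinner_unit scaleC_one flip: power2_norm_eq_inner)
  finally have k0: "0 \<le> k" .
  have bp: "b\<^sup>2 * p \<le> b\<^sup>2 * a\<^sup>2" and aq: "a\<^sup>2 * q \<le> a\<^sup>2 * b\<^sup>2"
    using p q by (auto intro!: mult_left_mono)
  have "a\<^sup>2 * b\<^sup>2 = b\<^sup>2 * a\<^sup>2" by (rule mult.commute)
  with k0 bp aq have k: "k = 0" and "b\<^sup>2 * p = b\<^sup>2 * a\<^sup>2" "a\<^sup>2 * q = a\<^sup>2 * b\<^sup>2"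
    unfolding k_def by linarith+
  then have pq: "p = a\<^sup>2" "q = b\<^sup>2" using ab by auto
  from k dd have "d = 0" by (simp add: ip_eq_0_iff)
  then show "norm y *\<^sub>R act (\<xi> \<otimes>\<^sub>H \<eta>) x = norm x *\<^sub>R act (\<xi> \<otimes>\<^sub>H \<xi>) y"
    by (simp add: d_def x1_def y1_def a_def b_def)
  show "ip x x \<eta> = (norm x)\<^sup>2 *\<^sub>R \<eta>"
    using eigenvector_if_maximal[of \<eta> "ip x x"] unit pq
    by (simp add: norm_ip_self p_def a_def)
  show "ip y y \<xi> = (norm y)\<^sup>2 *\<^sub>R \<xi>"
    using eigenvector_if_maximal[of \<xi> "ip y y"] unit pq
    by (simp add: norm_ip_self q_def b_def)
qed

text \<open>For \<open>x = y\<close> the norm equality always holds, so this also shows that a nonzero module contains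
  basic vectors and that \<open>\<theta>\<^sub>x\<close> has the eigenvalue \<open>\<parallel>x\<parallel>\<^sup>2\<close> if \<open>x \<noteq> 0\<close>.\<close>

lemma common_basic_eigenvector:
  assumes nz: "x \<noteq> 0" "y \<noteq> 0" and eq: "norm (ip x y) = norm x * norm y"
  obtains z \<xi> where "norm \<xi> = 1" and "ip z z = \<xi> \<otimes>\<^sub>H \<xi>"
    and "theta act ip x x z = complex_of_real ((norm x)\<^sup>2) *\<^sub>C z"
    and "theta act ip y y z = complex_of_real ((norm y)\<^sup>2) *\<^sub>C z"
proof -
  define t where "t = norm x * norm y"
  have t: "0 < t" using nz by (simp add: t_def)
  then have "ip x y \<noteq> 0" using eq by (auto simp: t_def)
  then obtain \<xi> where \<xi>: "norm \<xi> = 1" and ev: "ip y x (ip x y \<xi>) = t\<^sup>2 *\<^sub>R \<xi>"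
    using compact_operator_attains_norm[OF ip_compact ip_adjoint[of y x]] eq
    unfolding t_def by metis
  define \<eta> where "\<eta> = ip x y \<xi> /\<^sub>R t"
  have "(norm (ip x y \<xi>))\<^sup>2 = inner (ip y x (ip x y \<xi>)) \<xi>"
    by (simp add: inner_adjoint[OF ip_adjoint] power2_norm_eq_inner)
  also have "\<dots> = t\<^sup>2" using \<xi> by (simp add: ev flip: power2_norm_eq_inner)
  finally have "norm (ip x y \<xi>) = t"
    by (rule power2_eq_imp_eq) (use t in auto)
  then have \<eta>: "norm \<eta> = 1" using t by (simp add: \<eta>_def)
  have yx: "ip y x \<eta> = (norm x * norm y) *\<^sub>R \<xi>"
    using t by (simp add: \<eta>_def blinfun.scaleR_right ev power2_eq_square flip: t_def)
  have pos: "0 < norm x" "0 < norm y" using nz by auto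
  note al = act_rank_one_aligned[OF \<xi> \<eta> pos yx]
  define z where "z = act (\<xi> \<otimes>\<^sub>H \<xi>) y /\<^sub>R norm y"
  \<comment> \<open>The two descriptions of \<open>z\<close> exhibit it as an eigenvector of \<open>\<theta>\<^sub>y\<close> and of \<open>\<theta>\<^sub>x\<close>.\<close>
  have z: "z = act (\<xi> \<otimes>\<^sub>H \<eta>) x /\<^sub>R norm x"
  proof -
    have "z = (norm x *\<^sub>R act (\<xi> \<otimes>\<^sub>H \<xi>) y) /\<^sub>R (norm x * norm y)"
      using pos by (simp add: z_def field_simps)
    also have "\<dots> = act (\<xi> \<otimes>\<^sub>H \<eta>) x /\<^sub>R norm x"
      unfolding al(1)[symmetric] using pos by (simp add: field_simps)
    finally show ?thesis .
  qed
  have swap: "A (r *\<^sub>R v) = c *\<^sub>C (r *\<^sub>R v)" if "A v = c *\<^sub>C v" for A :: "'e \<Rightarrow>\<^sub>L 'e" and r c v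
    by (simp add: blinfun.scaleR_right that) (simp add: scaleR_scaleC scaleC_scaleC mult.commute)
  show thesis
  proof
    show "norm \<xi> = 1" by fact
    show "theta act ip x x z = complex_of_real ((norm x)\<^sup>2) *\<^sub>C z"
      unfolding z by (rule swap[OF theta_act_eigenvector[OF al(2)]])
    show "theta act ip y y z = complex_of_real ((norm y)\<^sup>2) *\<^sub>C z"
      unfolding z_def by (rule swap[OF theta_act_eigenvector[OF al(3)]])
    have zv: "ip z v = (\<xi> \<otimes>\<^sub>H ip v y \<xi>) /\<^sub>R norm y" for v
      by (simp add: z_def scaleR_scaleC ip_scaleC_left ip_act_rank_one)
    have zy: "ip z y = \<xi> \<otimes>\<^sub>H (complex_of_real (norm y) *\<^sub>C \<xi>)"
      unfolding zv al(3) using pos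
      by (simp add: scaleR_scaleC rank_one_scaleC_right scaleC_scaleC power2_eq_square field_simps)
    have "ip z y \<xi> = norm y *\<^sub>R \<xi>"
      by (simp add: zy cinner_unit \<xi> cinner_scaleC_right scaleR_scaleC)
    then show "ip z z = \<xi> \<otimes>\<^sub>H \<xi>"
      unfolding zv using pos
      by (simp add: scaleR_scaleC rank_one_scaleC_right scaleC_scaleC scaleC_one field_simps)
  qed
qed

section \<open>Parallelism and the norm of the inner product\<close>

lemma norm_add_square_le: "(norm (u + v))\<^sup>2 \<le> (norm u)\<^sup>2 + (norm v)\<^sup>2 + 2 * norm (ip u v)"
proof -
  have "(norm (u + v))\<^sup>2 = norm (ip u u + ip v v + (ip u v + ip v u))"
    by (simp add: ip_add_left ip_add_right algebra_simps flip: norm_ip_self)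
  also have "\<dots> \<le> norm (ip u u) + norm (ip v v) + (norm (ip u v) + norm (ip v u))"
    by (intro norm_triangle_mono order_refl)
  finally show ?thesis by (simp add: norm_ip_self norm_ip_commute[of v u])
qed

lemma norm_theta_le: "norm (theta act ip x y) \<le> norm x * norm y"
proof (rule norm_blinfun_bound)
  fix z
  have "norm (act (ip z y) x) \<le> norm (ip z y) * norm x" by (rule norm_act_le[OF ip_compact])
  also have "\<dots> \<le> (norm z * norm y) * norm x" by (intro mult_right_mono norm_ip_le) simp
  finally show "norm (theta act ip x y z) \<le> norm x * norm y * norm z"
    by (simp add: theta_apply mult_ac)
qed simp

lemma norm_le_eigenvalue:
  assumes "ip z z = \<xi> \<otimes>\<^sub>H \<xi>" "norm \<xi> = 1" "blinfun_apply A z = complex_of_real r *\<^sub>C z"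
  shows "r \<le> norm (A :: 'e \<Rightarrow>\<^sub>L 'e)"
proof -
  have "ip z z \<xi> \<noteq> 0" using assms by (auto simp: cinner_unit scaleC_one)
  then have "0 < norm z" using ip_eq_0_iff[of z] by auto
  moreover have "\<bar>r\<bar> * norm z \<le> norm A * norm z"
    using norm_blinfun[of A z] assms(3) by (simp add: norm_scaleC)
  ultimately show ?thesis by simp
qed

lemma norm_theta_self: "norm (theta act ip x x) = (norm x)\<^sup>2"
proof (cases "x = 0")
  case True
  then show ?thesis using norm_theta_le[of x x] by simp
next
  case False
  then obtain z \<xi> where "norm \<xi> = 1" "ip z z = \<xi> \<otimes>\<^sub>H \<xi>"
    "theta act ip x x z = complex_of_real ((norm x)\<^sup>2) *\<^sub>C z"
    using common_basic_eigenvector[of x x] norm_ip_self[of x] by (metis power2_eq_square)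
  from norm_le_eigenvalue[OF this(2,1,3)] norm_theta_le[of x x]
  show ?thesis by (simp add: power2_eq_square)
qed

text \<open>If the norm on the left is \<open>a\<^sup>2 + b\<^sup>2\<close>, the fourth powers cancel and there remains
  \<open>a b \<cdot> a b \<le> a b \<parallel>\<langle>x, y\<rangle>\<parallel>\<close>. The factor \<open>\<parallel>\<langle>x, y\<rangle>\<parallel>\<close> comes from the mixed term, since
  \<open>\<langle>\<theta>\<^sub>x z, \<theta>\<^sub>y z\<rangle> = \<langle>z, x\<rangle> \<langle>x, y\<rangle> \<langle>y, z\<rangle>\<close>.\<close>

lemma norm_theta_add_square_le:
  assumes "cmod c = 1"
  shows "(norm (theta act ip x x + c *\<^sub>C theta act ip y y))\<^sup>2
    \<le> (norm x)\<^sup>2 * (norm x)\<^sup>2 + (norm y)\<^sup>2 * (norm y)\<^sup>2 + 2 * (norm x * norm y * norm (ip x y))"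
    (is "(norm ?A)\<^sup>2 \<le> ?M")
proof -
  have M: "0 \<le> ?M" by simp
  have "norm ?A \<le> sqrt ?M"
  proof (rule norm_blinfun_bound)
    show "0 \<le> sqrt ?M" using M by (rule real_sqrt_ge_zero)
    fix z
    let ?u = "theta act ip x x z" and ?v = "theta act ip y y z"
    have bd: "(norm (theta act ip w w z))\<^sup>2 \<le> (norm w)\<^sup>2 * (norm w)\<^sup>2 * (norm z)\<^sup>2" for w
      using power_mono[OF norm_blinfun[of "theta act ip w w" z], of 2]
      by (simp add: norm_theta_self power_mult_distrib power2_eq_square[of "(norm w)\<^sup>2"])
    have "norm (ip ?u ?v) = norm (ip z x o\<^sub>L ip x ?v)"
      by (simp add: theta_apply ip_act[OF ip_compact])
    also have "\<dots> \<le> norm (ip z x) * norm (ip ?v x)"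
      by (subst norm_ip_commute[of ?v]) (rule norm_blinfun_compose)
    also have "ip ?v x = ip z y o\<^sub>L ip y x"
      by (simp add: theta_apply ip_act[OF ip_compact])
    also have "norm (ip z x) * norm (ip z y o\<^sub>L ip y x)
        \<le> (norm z * norm x) * ((norm z * norm y) * norm (ip x y))"
      by (intro mult_mono norm_ip_le order_trans[OF norm_blinfun_compose])
        (auto simp: norm_ip_commute[of y x])
    finally have cross: "norm (ip ?u ?v) \<le> norm x * norm y * norm (ip x y) * (norm z)\<^sup>2"
      by (simp add: power2_eq_square mult_ac)
    have "(norm (?A z))\<^sup>2 = (norm (?u + c *\<^sub>C ?v))\<^sup>2"
      by (simp add: blinfun.add_left scaleC_blinfun.rep_eq)
    also have "\<dots> \<le> (norm ?u)\<^sup>2 + (norm ?v)\<^sup>2 + 2 * norm (ip ?u ?v)"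
      using norm_add_square_le[of ?u "c *\<^sub>C ?v"] assms
      by (simp add: norm_scaleC ip_scaleC_right)
    also have "\<dots> \<le> ?M * (norm z)\<^sup>2"
      using bd[of x] bd[of y] cross by (simp add: algebra_simps)
    also have "\<dots> = (sqrt ?M * norm z)\<^sup>2"
      using M by (simp add: power_mult_distrib)
    finally show "norm (?A z) \<le> sqrt ?M * norm z"
      by (rule power2_le_imp_le) (use M in simp)
  qed
  then have "(norm ?A)\<^sup>2 \<le> (sqrt ?M)\<^sup>2" by (rule power_mono) (rule norm_ge_zero)
  then show ?thesis using M by simp
qed

lemma norm_parallel_imp_norm_ip:
  assumes "norm_parallel (theta act ip x x) (theta act ip y y)"
  shows "norm (ip x y) = norm x * norm y"
proof -
  define m where "m = norm x * norm y"
  obtain c where "cmod c = 1"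
    "norm (theta act ip x x + c *\<^sub>C theta act ip y y) = (norm x)\<^sup>2 + (norm y)\<^sup>2"
    using assms by (auto simp: norm_parallel_def norm_theta_self)
  with norm_theta_add_square_le[of c x y] have "m * m \<le> m * norm (ip x y)"
    by (simp add: m_def power2_eq_square algebra_simps)
  moreover have "0 \<le> m" by (simp add: m_def)
  moreover have "norm (ip x y) \<le> m" unfolding m_def by (rule norm_ip_le)
  ultimately have "norm (ip x y) = m"
    by (cases "m = 0") auto
  then show ?thesis by (simp add: m_def)
qed

lemma norm_ip_imp_norm_parallel:
  assumes "norm (ip x y) = norm x * norm y"
  shows "norm_parallel (theta act ip x x) (theta act ip y y)"
proof -
  let ?A = "theta act ip x x" and ?B = "theta act ip y y"
  have "norm (?A + ?B) = norm ?A + norm ?B"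
  proof (cases "x = 0 \<or> y = 0")
    case True
    then have "?A = 0 \<or> ?B = 0"
      using norm_theta_self[of x] norm_theta_self[of y] by auto
    then show ?thesis by auto
  next
    case False
    then obtain z \<xi> where z: "norm \<xi> = 1" "ip z z = \<xi> \<otimes>\<^sub>H \<xi>"
      "?A z = complex_of_real ((norm x)\<^sup>2) *\<^sub>C z" "?B z = complex_of_real ((norm y)\<^sup>2) *\<^sub>C z"
      using common_basic_eigenvector[of x y] assms by metis
    have "(?A + ?B) z = complex_of_real ((norm x)\<^sup>2 + (norm y)\<^sup>2) *\<^sub>C z"
      by (simp add: blinfun.add_left z(3,4) scaleC_add_left)
    from norm_le_eigenvalue[OF z(2,1) this] norm_triangle_ineq[of ?A ?B]
    show ?thesis by (simp add: norm_theta_self)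
  qed
  then show ?thesis
    unfolding norm_parallel_def by (intro exI[of _ 1]) (simp add: scaleC_one)
qed

section \<open>The limit condition on basic vectors\<close>

lemma limit_imp_norm_ip:
  fixes X :: "nat \<Rightarrow> 'e" and \<xi> :: "nat \<Rightarrow> 'h"
  assumes X: "\<And>n. norm (\<xi> n) = 1" "\<And>n. ip (X n) (X n) = \<xi> n \<otimes>\<^sub>H \<xi> n" and c: "cmod c = 1"
    and lim: "(\<lambda>n. cinner ((ip (X n) x o\<^sub>L ip x y o\<^sub>L ip y (X n)) (\<xi> n)) (\<xi> n))
               \<longlonglongrightarrow> c * complex_of_real ((norm x)\<^sup>2 * (norm y)\<^sup>2)"
  shows "norm (ip x y) = norm x * norm y"
proof -
  define m where "m = norm x * norm y"
  have "cmod (cinner ((ip (X n) x o\<^sub>L ip x y o\<^sub>L ip y (X n)) (\<xi> n)) (\<xi> n)) \<le> m * norm (ip x y)" for n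
  proof -
    let ?T = "ip (X n) x o\<^sub>L ip x y o\<^sub>L ip y (X n)"
    have "norm (X n) \<le> 1"
      using norm_rank_one_le[of "\<xi> n" "\<xi> n"] by (simp add: norm_eq X)
    then have bd: "norm (ip w (X n)) \<le> norm w" for w
      using norm_ip_le[of w "X n"] mult_left_mono[of "norm (X n)" 1 "norm w"] by simp
    have "cmod (cinner (?T (\<xi> n)) (\<xi> n)) \<le> norm (?T (\<xi> n))"
      using cinner_Cauchy_Schwarz[of "?T (\<xi> n)" "\<xi> n"] X by simp
    also have "\<dots> \<le> norm ?T" using norm_blinfun[of ?T "\<xi> n"] X by simp
    also have "\<dots> \<le> norm (ip (X n) x) * norm (ip x y) * norm (ip y (X n))"
      by (intro order_trans[OF norm_blinfun_compose] mult_right_mono norm_blinfun_compose) simp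
    also have "\<dots> \<le> norm x * norm (ip x y) * norm y"
      using bd[of x] bd[of y] by (intro mult_mono) (auto simp: norm_ip_commute[of x])
    finally show ?thesis by (simp add: m_def mult_ac)
  qed
  then have "cmod (c * complex_of_real ((norm x)\<^sup>2 * (norm y)\<^sup>2)) \<le> m * norm (ip x y)"
    by (intro Lim_norm_ubound[OF _ lim]) auto
  moreover have "cmod (c * complex_of_real ((norm x)\<^sup>2 * (norm y)\<^sup>2)) = m * m"
    using c by (simp add: norm_mult m_def power2_eq_square norm_power)
  ultimately have "m * m \<le> m * norm (ip x y)" by simp
  moreover have "0 \<le> m" by (simp add: m_def)
  moreover have "norm (ip x y) \<le> m" unfolding m_def by (rule norm_ip_le)
  ultimately have "norm (ip x y) = m"
    by (cases "m = 0") auto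
  then show ?thesis by (simp add: m_def)
qed

text \<open>If \<open>x\<close> or \<open>y\<close> vanishes, every basic vector will do; the nonzero vector \<open>w\<close> guarantees that
  there is one. Otherwise the common eigenvector \<open>z\<close> turns \<open>\<langle>z, x\<rangle> \<langle>x, y\<rangle> = \<langle>\<theta>\<^sub>x z, y\<rangle>\<close> into
  \<open>a\<^sup>2 \<langle>z, y\<rangle>\<close> and then \<open>\<langle>z, y\<rangle> \<langle>y, z\<rangle> = \<langle>\<theta>\<^sub>y z, z\<rangle>\<close> into \<open>b\<^sup>2 \<langle>z, z\<rangle>\<close>.\<close>

lemma norm_ip_imp_basic_vector:
  assumes "norm (ip x y) = norm x * norm y" and "w \<noteq> (0 :: 'e)"
  obtains z \<xi> where "norm \<xi> = 1" "ip z z = \<xi> \<otimes>\<^sub>H \<xi>"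
    "cinner ((ip z x o\<^sub>L ip x y o\<^sub>L ip y z) \<xi>) \<xi> = complex_of_real ((norm x)\<^sup>2 * (norm y)\<^sup>2)"
proof (cases "x = 0 \<or> y = 0")
  case True
  obtain z \<xi> where z: "norm \<xi> = 1" "ip z z = \<xi> \<otimes>\<^sub>H \<xi>"
    using common_basic_eigenvector[of w w] assms(2) norm_ip_self[of w]
    by (metis power2_eq_square)
  from True assms(1) have "ip x y = 0" by auto
  then have "cinner ((ip z x o\<^sub>L ip x y o\<^sub>L ip y z) \<xi>) \<xi> = 0"
    using cinner_Cauchy_Schwarz[of 0 \<xi>] by simp
  with True show thesis by (intro that[OF z]) auto
next
  case False
  then obtain z \<xi> where z: "norm \<xi> = 1" "ip z z = \<xi> \<otimes>\<^sub>H \<xi>"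
    "theta act ip x x z = complex_of_real ((norm x)\<^sup>2) *\<^sub>C z"
    "theta act ip y y z = complex_of_real ((norm y)\<^sup>2) *\<^sub>C z"
    using common_basic_eigenvector[of x y] assms by metis
  have 1: "ip z w o\<^sub>L ip w v = complex_of_real ((norm w)\<^sup>2) *\<^sub>C ip z v"
    if "theta act ip w w z = complex_of_real ((norm w)\<^sup>2) *\<^sub>C z" for w v
    using that by (simp add: theta_apply ip_scaleC_left flip: ip_act[OF ip_compact])
  have "(ip z x o\<^sub>L ip x y) o\<^sub>L ip y z = complex_of_real ((norm x)\<^sup>2) *\<^sub>C (ip z y o\<^sub>L ip y z)"
    unfolding 1[OF z(3)] by (rule blinfun_eqI) (simp add: scaleC_blinfun.rep_eq)
  also have "\<dots> = complex_of_real ((norm x)\<^sup>2 * (norm y)\<^sup>2) *\<^sub>C (\<xi> \<otimes>\<^sub>H \<xi>)"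
    unfolding 1[OF z(4)] z(2) by (simp add: scaleC_scaleC)
  finally have "cinner ((ip z x o\<^sub>L ip x y o\<^sub>L ip y z) \<xi>) \<xi> = complex_of_real ((norm x)\<^sup>2 * (norm y)\<^sup>2)"
    using z(1) by (simp add: scaleC_blinfun.rep_eq cinner_scaleC_left cinner_unit scaleC_one)
  then show thesis by (rule that[OF z(1,2)])
qed

end

theorem proposition3p9:
  fixes act :: "('h :: chilbert_space \<Rightarrow>\<^sub>L 'h) \<Rightarrow> 'e :: {complex_normed_vector, banach} \<Rightarrow> 'e"
    and ip :: "'e \<Rightarrow> 'e \<Rightarrow> ('h \<Rightarrow>\<^sub>L 'h)"
    and x y :: 'e
  assumes "hilbert_K_module act ip"
    and nonzero: "\<exists>z :: 'e. z \<noteq> 0"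
  shows "(norm_parallel (theta act ip x x) (theta act ip y y) \<longleftrightarrow>
           norm (ip x y) = norm x * norm y) \<and>
         ((\<exists>(X :: nat \<Rightarrow> 'e) (\<xi> :: nat \<Rightarrow> 'h) (c :: complex).
             (\<forall>n. basic ip (X n) \<and> norm (\<xi> n) = 1 \<and> ip (X n) (X n) = \<xi> n \<otimes>\<^sub>H \<xi> n) \<and>
             cmod c = 1 \<and>
             (\<lambda>n. cinner ((ip (X n) x o\<^sub>L ip x y o\<^sub>L ip y (X n)) (\<xi> n)) (\<xi> n))
               \<longlonglongrightarrow> c * complex_of_real ((norm x)\<^sup>2 * (norm y)\<^sup>2)) \<longleftrightarrow>
           norm (ip x y) = norm x * norm y)"
proof -
  interpret hilbert_K_module act ip by fact
  from nonzero obtain w :: 'e where w: "w \<noteq> 0" by blast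
  show ?thesis
  proof (intro conjI iffI)
    assume "norm_parallel (theta act ip x x) (theta act ip y y)"
    then show "norm (ip x y) = norm x * norm y" by (rule norm_parallel_imp_norm_ip)
  next
    assume "norm (ip x y) = norm x * norm y"
    then show "norm_parallel (theta act ip x x) (theta act ip y y)"
      by (rule norm_ip_imp_norm_parallel)
  next
    assume "\<exists>(X :: nat \<Rightarrow> 'e) (\<xi> :: nat \<Rightarrow> 'h) c.
        (\<forall>n. basic ip (X n) \<and> norm (\<xi> n) = 1 \<and> ip (X n) (X n) = \<xi> n \<otimes>\<^sub>H \<xi> n) \<and>
        cmod c = 1 \<and>
        (\<lambda>n. cinner ((ip (X n) x o\<^sub>L ip x y o\<^sub>L ip y (X n)) (\<xi> n)) (\<xi> n))
          \<longlonglongrightarrow> c * complex_of_real ((norm x)\<^sup>2 * (norm y)\<^sup>2)"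
    then show "norm (ip x y) = norm x * norm y" using limit_imp_norm_ip by blast
  next
    assume "norm (ip x y) = norm x * norm y"
    then obtain z \<xi> where z: "norm \<xi> = 1" "ip z z = \<xi> \<otimes>\<^sub>H \<xi>"
      "cinner ((ip z x o\<^sub>L ip x y o\<^sub>L ip y z) \<xi>) \<xi> = complex_of_real ((norm x)\<^sup>2 * (norm y)\<^sup>2)"
      using norm_ip_imp_basic_vector[OF _ w] by blast
    have "basic ip z"
      unfolding basic_def z(2) by (rule minimal_projection_rank_one[OF z(1)])
    then show "\<exists>(X :: nat \<Rightarrow> 'e) (\<xi> :: nat \<Rightarrow> 'h) c.
        (\<forall>n. basic ip (X n) \<and> norm (\<xi> n) = 1 \<and> ip (X n) (X n) = \<xi> n \<otimes>\<^sub>H \<xi> n) \<and>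
        cmod c = 1 \<and>
        (\<lambda>n. cinner ((ip (X n) x o\<^sub>L ip x y o\<^sub>L ip y (X n)) (\<xi> n)) (\<xi> n))
          \<longlonglongrightarrow> c * complex_of_real ((norm x)\<^sup>2 * (norm y)\<^sup>2)"
      using z
      by (intro exI[of _ "\<lambda>_. z"] exI[of _ "\<lambda>_. \<xi>"] exI[of _ 1]) simp
  qed
qed

end
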